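(* If $G$ is a bipartite graph with no induced path on $6$ vertices, then $\operatorname{reg}(G)=\operatorname{im}(G)$.
   Context: $\operatorname{reg}(G)=\max\{j\ge0:\widetilde H_{j-1}(\operatorname{Ind}(G[S]);\Bbbk)\neq0\text{ for some }S\subseteq V(G)\}$ over a field $\Bbbk$ ($\operatorname{Ind}$ = independence complex). $\operatorname{im}(G)$ is the induced matching number: maximum size of a set of edges that are pairwise vertex-disjoint and such that no edge of $G$ joins two of them. *)

theory Defs
  imports Main
begin

definition simple_graph :: "'a set \<Rightarrow> 'a set set \<Rightarrow> bool" where
  "simple_graph V E \<longleftrightarrow> finite V \<and> (\<forall>e\<in>E. e \<subseteq> V \<and> card e = 2)"

definition bipartite :: "'a set \<Rightarrow> 'a set set \<Rightarrow> bool" where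
  "bipartite V E \<longleftrightarrow> (\<exists>A B. A \<union> B = V \<and> A \<inter> B = {} \<and>
      (\<forall>e\<in>E. e \<inter> A \<noteq> {} \<and> e \<inter> B \<noteq> {}))"

definition has_induced_path :: "nat \<Rightarrow> 'a set \<Rightarrow> 'a set set \<Rightarrow> bool" where
  "has_induced_path n V E \<longleftrightarrow> (\<exists>p :: nat \<Rightarrow> 'a. inj_on p {0..<n} \<and> p ` {0..<n} \<subseteq> V \<and>
      (\<forall>i<n. \<forall>j<n. {p i, p j} \<in> E \<longleftrightarrow> (i = j + 1 \<or> j = i + 1)))"

definition induced_matching :: "'a set set \<Rightarrow> 'a set set \<Rightarrow> bool" where
  "induced_matching E M \<longleftrightarrow> M \<subseteq> E \<and>
      (\<forall>e\<in>M. \<forall>f\<in>M. e \<noteq> f \<longrightarrow> e \<inter> f = {} \<and> (\<forall>x\<in>e. \<forall>y\<in>f. {x, y} \<notin> E))"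

definition im :: "'a set set \<Rightarrow> nat" where
  "im E = Max {card M | M. induced_matching E M}"

definition Ind :: "'a set set \<Rightarrow> 'a set \<Rightarrow> 'a set set" where
  "Ind E S = {\<sigma>. \<sigma> \<subseteq> S \<and> (\<forall>x\<in>\<sigma>. \<forall>y\<in>\<sigma>. {x, y} \<notin> E)}"

text \<open>Augmented (reduced) simplicial chain complex over a field 'k, with orientation induced
  by the linear order on vertices. A chain is a function from faces to 'k.
  Boundary: (d c)(tau) = sum over v not in tau with tau+v a face of (-1)^#{u in tau+v. u < v} c(tau+v).\<close>
definition bd :: "('a::linorder) set set \<Rightarrow> ('a set \<Rightarrow> 'k::field) \<Rightarrow> 'a set \<Rightarrow> 'k" where
  "bd K c \<tau> = (if \<tau> \<in> K then
      (\<Sum>v\<in>{v. v \<notin> \<tau> \<and> insert v \<tau> \<in> K}.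
          (-1) ^ card {u\<in>insert v \<tau>. u < v} * c (insert v \<tau>))
    else 0)"

definition chain :: "'a set set \<Rightarrow> nat \<Rightarrow> ('a set \<Rightarrow> 'k::zero) \<Rightarrow> bool" where
  "chain K m c \<longleftrightarrow> (\<forall>\<sigma>. c \<sigma> \<noteq> 0 \<longrightarrow> \<sigma> \<in> K \<and> card \<sigma> = m)"

text \<open>Reduced homology in dimension m-1 (faces with m vertices) is nonzero over 'k:
  some cycle is not a boundary.\<close>
definition red_homology_nonzero ::
    "'k::field itself \<Rightarrow> ('a::linorder) set set \<Rightarrow> nat \<Rightarrow> bool" where
  "red_homology_nonzero _ K m \<longleftrightarrow>
     (\<exists>z :: 'a set \<Rightarrow> 'k. chain K m z \<and> bd K z = (\<lambda>_. 0) \<and>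
        \<not> (\<exists>w :: 'a set \<Rightarrow> 'k. chain K (m + 1) w \<and> bd K w = z))"

definition reg :: "'k::field itself \<Rightarrow> ('a::linorder) set \<Rightarrow> 'a set set \<Rightarrow> nat" where
  "reg k V E = Max {j. \<exists>S\<subseteq>V. red_homology_nonzero k (Ind E S) j}"

end

(* The union of an induced matching with m edges induces an m-fold suspension of the complex {{}},
   which has homology on faces with m vertices. Conversely, delete vertices one at a time: by the
   long exact sequence of a vertex x, homology of Ind S in degree j survives in S - x or, in degree
   j - 1, in S - N[x]. Take an induced matching of the smaller graph. In the second case
   P6-freeness implies that either an edge at x extends the matching, or some a has
   N(x) <= N(a), and then a can be removed without losing homology. *)
theory Submission
  imports Defs
begin

section \<open>Simplicial complexes; deletion and link of a vertex\<close>

definition complex :: "'a set set \<Rightarrow> bool" where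
  "complex K \<longleftrightarrow> finite K \<and> (\<forall>\<sigma>\<in>K. finite \<sigma> \<and> (\<forall>\<tau>\<subseteq>\<sigma>. \<tau> \<in> K))"

definition deletion :: "'a set set \<Rightarrow> 'a \<Rightarrow> 'a set set" where
  "deletion K x = {\<tau>\<in>K. x \<notin> \<tau>}"

definition link :: "'a set set \<Rightarrow> 'a \<Rightarrow> 'a set set" where
  "link K x = {\<tau>. x \<notin> \<tau> \<and> insert x \<tau> \<in> K}"

text \<open>Assembles a chain from a part \<open>p\<close> away from \<open>x\<close> and a part
  \<open>q\<close> through \<open>x\<close>, the latter indexed by faces with \<open>x\<close>
  removed. The sign is the one \<open>bd\<close> attaches to removing \<open>x\<close> from
  \<open>\<tau>\<close>, so that \<open>q\<close> enters the boundary with coefficient +1.\<close>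

definition chain_pair ::
    "'a::linorder \<Rightarrow> ('a set \<Rightarrow> 'k::field) \<Rightarrow> ('a set \<Rightarrow> 'k) \<Rightarrow> 'a set \<Rightarrow> 'k" where
  "chain_pair x p q \<tau> =
     (if x \<in> \<tau> then (-1) ^ card {u\<in>\<tau>. u < x} * q (\<tau> - {x}) else p \<tau>)"

lemma complex_deletion: "complex K \<Longrightarrow> complex (deletion K x)"
  unfolding complex_def deletion_def by auto

lemma link_subset_deletion: "complex K \<Longrightarrow> link K x \<subseteq> deletion K x"
  unfolding complex_def deletion_def link_def by auto

lemma complex_link:
  assumes "complex K"
  shows "complex (link K x)"
proof -
  have "\<tau>' \<in> link K x" if "\<tau> \<in> link K x" "\<tau>' \<subseteq> \<tau>" for \<tau> \<tau>'
  proof -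
    have "insert x \<tau>' \<subseteq> insert x \<tau>" "insert x \<tau> \<in> K" "x \<notin> \<tau>'"
      using that by (auto simp: link_def)
    with assms show ?thesis unfolding complex_def link_def by blast
  qed
  moreover have "link K x \<subseteq> K"
    using link_subset_deletion[OF assms] by (auto simp: deletion_def)
  ultimately show ?thesis
    using assms finite_subset unfolding complex_def by (metis subsetD)
qed

section \<open>Boundaries and chains: linearity and subcomplexes\<close>

lemma finite_cofaces:
  assumes "finite K"
  shows "finite {v. v \<notin> \<tau> \<and> insert v \<tau> \<in> K}"
proof (rule finite_imageD)
  show "finite ((\<lambda>v. insert v \<tau>) ` {v. v \<notin> \<tau> \<and> insert v \<tau> \<in> K})"
    by (rule finite_subset[OF _ assms]) auto
  show "inj_on (\<lambda>v. insert v \<tau>) {v. v \<notin> \<tau> \<and> insert v \<tau> \<in> K}"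
    by (auto simp: inj_on_def)
qed

lemma bd_add: "bd K (\<lambda>\<sigma>. c \<sigma> + d \<sigma>) = (\<lambda>\<tau>. bd K c \<tau> + bd K d \<tau>)"
  unfolding bd_def by (auto simp: fun_eq_iff distrib_left sum.distrib)

lemma bd_uminus: "bd K (\<lambda>\<sigma>. - c \<sigma>) = (\<lambda>\<tau>. - bd K c \<tau>)"
  unfolding bd_def by (auto simp: fun_eq_iff sum_negf)

lemma bd_zero: "bd K (\<lambda>_. 0) = (\<lambda>_. 0)"
  unfolding bd_def by (auto simp: fun_eq_iff)

text \<open>Cofaces outside \<open>L\<close> carry coefficient 0, and a set outside \<open>L\<close>
  has no coface in \<open>L\<close> because \<open>L\<close> is closed under subsets.\<close>

lemma bd_subcomplex:
  assumes "complex K" "complex L" "L \<subseteq> K" "chain L m c"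
  shows "bd K c = bd L c"
proof
  fix \<tau>
  have *: "c (insert v \<tau>) = 0" if "insert v \<tau> \<notin> L" for v
    using assms(4) that unfolding chain_def by blast
  show "bd K c \<tau> = bd L c \<tau>"
  proof (cases "\<tau> \<in> L")
    case True
    then have "(\<Sum>v\<in>{v. v \<notin> \<tau> \<and> insert v \<tau> \<in> L}.
          (-1) ^ card {u\<in>insert v \<tau>. u < v} * c (insert v \<tau>)) =
        (\<Sum>v\<in>{v. v \<notin> \<tau> \<and> insert v \<tau> \<in> K}.
          (-1) ^ card {u\<in>insert v \<tau>. u < v} * c (insert v \<tau>))"
      using assms * by (intro sum.mono_neutral_left finite_cofaces) (auto simp: complex_def)
    with True assms(3) show ?thesis unfolding bd_def by auto
  next
    case False
    then have "insert v \<tau> \<notin> L" for v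
      using assms(2) unfolding complex_def by blast
    with False show ?thesis unfolding bd_def by (simp add: *)
  qed
qed

lemma chain_add:
  fixes c d :: "'a set \<Rightarrow> 'k::field"
  shows "chain K m c \<Longrightarrow> chain K m d \<Longrightarrow> chain K m (\<lambda>\<sigma>. c \<sigma> + d \<sigma>)"
  unfolding chain_def by (metis add.right_neutral)

lemma chain_uminus:
  fixes c :: "'a set \<Rightarrow> 'k::field"
  shows "chain K m c \<Longrightarrow> chain K m (\<lambda>\<sigma>. - c \<sigma>)"
  unfolding chain_def by simp

lemma chain_zero: "chain K m (\<lambda>_. 0)"
  unfolding chain_def by simp

lemma chain_mono: "chain K m c \<Longrightarrow> K \<subseteq> L \<Longrightarrow> chain L m c"
  unfolding chain_def by blast

section \<open>Splitting chains at a vertex\<close>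

lemma chain_chain_pair:
  fixes p q :: "'a::linorder set \<Rightarrow> 'k::field"
  assumes "complex K" "chain (deletion K x) (Suc m) p" "chain (link K x) m q"
  shows "chain K (Suc m) (chain_pair x p q)"
  unfolding chain_def
proof (intro allI impI)
  fix \<sigma> assume nz: "chain_pair x p q \<sigma> \<noteq> 0"
  show "\<sigma> \<in> K \<and> card \<sigma> = Suc m"
  proof (cases "x \<in> \<sigma>")
    case True
    with nz have "q (\<sigma> - {x}) \<noteq> 0" by (auto simp: chain_pair_def)
    then have *: "\<sigma> - {x} \<in> link K x" "card (\<sigma> - {x}) = m"
      using assms(3) unfolding chain_def by blast+
    then have "\<sigma> \<in> K" using True by (simp add: link_def insert_absorb)
    moreover have "finite \<sigma>" using \<open>\<sigma> \<in> K\<close> assms(1) by (auto simp: complex_def)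
    ultimately show ?thesis using * True by (metis card_Suc_Diff1)
  next
    case False
    with nz assms(2) show ?thesis by (auto simp: chain_pair_def chain_def deletion_def)
  qed
qed

lemma chain_pair_cases:
  fixes z :: "'a::linorder set \<Rightarrow> 'k::field"
  assumes "complex K" "chain K (Suc m) z"
  obtains p q where "chain (deletion K x) (Suc m) p" "chain (link K x) m q"
    "z = chain_pair x p q"
proof
  let ?p = "\<lambda>\<tau>. if x \<in> \<tau> then 0 else z \<tau>"
  \<comment> \<open>The sign of \<open>chain_pair\<close> is its own inverse, so multiplying by it
    once more recovers \<open>z\<close> on the faces through \<open>x\<close>.\<close>
  let ?q = "\<lambda>\<tau>. if x \<in> \<tau> then 0 else (-1) ^ card {u\<in>\<tau>. u < x} * z (insert x \<tau>)"
  show "chain (deletion K x) (Suc m) ?p"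
    using assms(2) by (auto simp: chain_def deletion_def)
  show "chain (link K x) m ?q"
    unfolding chain_def
  proof (intro allI impI)
    fix \<sigma> assume "?q \<sigma> \<noteq> 0"
    then have x: "x \<notin> \<sigma>" and "z (insert x \<sigma>) \<noteq> 0" by (auto split: if_splits)
    then have *: "insert x \<sigma> \<in> K" "card (insert x \<sigma>) = Suc m"
      using assms(2) by (auto simp: chain_def)
    then have "finite (insert x \<sigma>)" using assms(1) unfolding complex_def by blast
    with * x show "\<sigma> \<in> link K x \<and> card \<sigma> = m" by (auto simp: link_def)
  qed
  \<comment> \<open>Adding or removing \<open>x\<close> does not change which vertices lie below
    \<open>x\<close>, so the two signs agree and their product is an even power of -1.\<close>
  have sign: "{u. (u = x \<or> u \<in> \<tau>) \<and> u < x} = {u\<in>\<tau>. u < x}"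
      "{u\<in>\<tau>. u \<noteq> x \<and> u < x} = {u\<in>\<tau>. u < x}" for \<tau> by auto
  have "z \<tau> = chain_pair x ?p ?q \<tau>" for \<tau>
  proof (cases "x \<in> \<tau>")
    case True
    then have "insert x (\<tau> - {x}) = \<tau>" by auto
    with True show ?thesis
      by (auto simp: chain_pair_def sign mult.assoc[symmetric] power_add[symmetric]
          mult_2[symmetric] power_mult)
  qed (simp add: chain_pair_def)
  then show "z = chain_pair x ?p ?q" by blast
qed

text \<open>The chain complex of \<open>K\<close> is the mapping cone of the inclusion of the link into the
  deletion.\<close>
lemma bd_chain_pair:
  fixes p q :: "'a::linorder set \<Rightarrow> 'k::field"
  assumes K: "complex K" and q: "chain (link K x) m q"
  shows "bd K (chain_pair x p q) =
    chain_pair x (\<lambda>\<tau>. bd (deletion K x) p \<tau> + q \<tau>) (\<lambda>\<tau>. - bd (link K x) q \<tau>)"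
proof
  fix \<tau>
  let ?s = "\<lambda>v \<tau>. (-1) ^ card {u\<in>insert v \<tau>. u < v} :: 'k"
  let ?C = "{v. v \<notin> \<tau> \<and> insert v \<tau> \<in> K}"
  have finC: "finite ?C" using K by (intro finite_cofaces) (simp add: complex_def)
  have q0: "q \<sigma> = 0" if "\<sigma> \<notin> link K x" for \<sigma>
    using q that unfolding chain_def by blast
  show "bd K (chain_pair x p q) \<tau> =
    chain_pair x (\<lambda>\<tau>. bd (deletion K x) p \<tau> + q \<tau>) (\<lambda>\<tau>. - bd (link K x) q \<tau>) \<tau>"
  proof (cases "\<tau> \<in> K")
    case False
    then have "\<tau> \<notin> link K x" "\<tau> \<notin> deletion K x"
      using link_subset_deletion[OF K, of x] by (auto simp: deletion_def)
    moreover have "\<tau> - {x} \<notin> link K x" if "x \<in> \<tau>"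
      using that False by (simp add: link_def insert_absorb)
    ultimately show ?thesis using False q0 by (simp add: bd_def chain_pair_def)
  next
    case \<tau>: True
    show ?thesis
    proof (cases "x \<in> \<tau>")
      case False
      have C: "?C - {x} = {v. v \<notin> \<tau> \<and> insert v \<tau> \<in> deletion K x}"
        using False by (auto simp: deletion_def)
      have "bd K (chain_pair x p q) \<tau> = (\<Sum>v\<in>?C. ?s v \<tau> * chain_pair x p q (insert v \<tau>))"
        using \<tau> by (simp add: bd_def)
      \<comment> \<open>Adding \<open>v = x\<close>, if this gives a face, contributes
        \<open>q \<tau>\<close> because its sign occurs twice. The cofaces that avoid
        \<open>x\<close> make up the boundary in the deletion.\<close>
      also have "\<dots> = (\<Sum>v\<in>?C - {x}. ?s v \<tau> * chain_pair x p q (insert v \<tau>)) +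
          (\<Sum>v\<in>?C \<inter> {x}. ?s v \<tau> * chain_pair x p q (insert v \<tau>))"
        using finC by (metis (no_types, lifting) add.commute sum.Int_Diff)
      also have "(\<Sum>v\<in>?C - {x}. ?s v \<tau> * chain_pair x p q (insert v \<tau>)) =
          (\<Sum>v\<in>?C - {x}. ?s v \<tau> * p (insert v \<tau>))"
        using False by (intro sum.cong) (auto simp: chain_pair_def)
      also have "\<dots> = bd (deletion K x) p \<tau>"
        unfolding C using \<tau> False by (simp add: bd_def deletion_def)
      also have "(\<Sum>v\<in>?C \<inter> {x}. ?s v \<tau> * chain_pair x p q (insert v \<tau>)) = q \<tau>"
      proof (cases "insert x \<tau> \<in> K")
        case True
        then have "?C \<inter> {x} = {x}" using False by auto
        then show ?thesis using False
          by (simp add: chain_pair_def mult.assoc[symmetric] power_add[symmetric]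
              mult_2[symmetric] power_mult)
      next
        case nK: False
        then have "?C \<inter> {x} = {}" by auto
        with nK q0 show ?thesis by (simp add: link_def)
      qed
      finally show ?thesis using False by (simp add: chain_pair_def[of x _ _ \<tau>])
    next
      case True
      define \<rho> where "\<rho> = \<tau> - {x}"
      have \<rho>: "\<tau> = insert x \<rho>" "x \<notin> \<rho>" using True by (auto simp: \<rho>_def)
      have fin: "finite \<rho>" using \<tau> \<rho> K unfolding complex_def by (metis finite_insert)
      have C: "?C = {v. v \<notin> \<rho> \<and> insert v \<rho> \<in> link K x}"
        using \<rho> by (auto simp: link_def insert_commute)
      have \<rho>l: "\<rho> \<in> link K x" using \<tau> \<rho> by (simp add: link_def)
      let ?e = "(-1) ^ card {u\<in>\<tau>. u < x} :: 'k"
      have summand: "?s v \<tau> * chain_pair x p q (insert v \<tau>) = - ?e * (?s v \<rho> * q (insert v \<rho>))"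
        if "v \<in> ?C" for v
      proof -
        have v: "v \<notin> \<rho>" "v \<noteq> x" using that \<rho> by auto
        have "insert v \<tau> - {x} = insert v \<rho>" using v \<rho> by auto
        then have cp: "chain_pair x p q (insert v \<tau>) =
            (-1) ^ card {u\<in>insert v \<tau>. u < x} * q (insert v \<rho>)"
          using True by (simp add: chain_pair_def)
        \<comment> \<open>The larger of \<open>x\<close> and \<open>v\<close> counts the smaller one
          in its sign: the sign of \<open>v\<close> gains \<open>x\<close> if \<open>x < v\<close>,
          and the sign of \<open>x\<close> gains \<open>v\<close> otherwise. Either way one factor
          -1 appears.\<close>
        have "?s v \<tau> * (-1) ^ card {u\<in>insert v \<tau>. u < x} = - ?e * ?s v \<rho>"
        proof (cases "x < v")
          case xv: True
          then have "{u\<in>insert v \<tau>. u < v} = insert x {u\<in>insert v \<rho>. u < v}"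
            "{u\<in>insert v \<tau>. u < x} = {u\<in>\<tau>. u < x}" using \<rho> by auto
          then show ?thesis using fin \<rho> v by simp
        next
          case False
          then have vx: "v < x" using v by auto
          then have "{u\<in>insert v \<tau>. u < v} = {u\<in>insert v \<rho>. u < v}"
            "{u\<in>insert v \<tau>. u < x} = insert v {u\<in>\<tau>. u < x}" using \<rho> by auto
          then show ?thesis using fin \<rho> v by simp
        qed
        then show ?thesis unfolding cp by (simp only: mult.assoc[symmetric])
      qed
      have "bd K (chain_pair x p q) \<tau> = (\<Sum>v\<in>?C. ?s v \<tau> * chain_pair x p q (insert v \<tau>))"
        using \<tau> by (simp add: bd_def)
      also have "\<dots> = (\<Sum>v\<in>?C. - ?e * (?s v \<rho> * q (insert v \<rho>)))"
        using summand by (intro sum.cong) auto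
      also have "\<dots> = - ?e * bd (link K x) q \<rho>"
        using \<rho>l unfolding C by (simp add: bd_def sum_distrib_left sum_negf)
      finally show ?thesis using True by (simp add: chain_pair_def[of x _ _ \<tau>] \<rho>_def)
    qed
  qed
qed

text \<open>The degree that \<open>chain_pair_cases\<close> leaves out: faces are finite, so only
  the empty face has cardinality 0, and it does not contain \<open>x\<close>.\<close>

lemma chain_0_chain_pair:
  assumes "complex K" "chain K 0 z"
  shows "chain (deletion K x) 0 z" "z = chain_pair x z (\<lambda>_. 0)"
proof -
  have "z \<sigma> = 0" if "x \<in> \<sigma>" for \<sigma>
    using assms that unfolding chain_def complex_def by (metis card_0_eq empty_iff)
  with assms(2) show "chain (deletion K x) 0 z" "z = chain_pair x z (\<lambda>_. 0)"
    unfolding chain_def deletion_def chain_pair_def by auto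
qed

section \<open>Homology of deletions, links, cones and suspensions\<close>

lemma red_homology_zeroD:
  fixes z :: "'a::linorder set \<Rightarrow> 'k::field"
  assumes "\<not> red_homology_nonzero TYPE('k) K m" "chain K m z" "bd K z = (\<lambda>_. 0)"
  obtains w where "chain K (Suc m) w" "bd K w = z"
  using assms unfolding red_homology_nonzero_def by auto

text \<open>Exactness at the middle term of the sequence from the deletion through \<open>K\<close>
  to the link, carried out on chains. If both outer groups vanish, a cycle \<open>(p, q)\<close> has
  \<open>q\<close> equal to the boundary of some \<open>r\<close> in the link and
  \<open>p + r\<close> equal to the boundary of some \<open>s\<close> in the deletion; then
  \<open>(s, -r)\<close> bounds \<open>(p, q)\<close>.\<close>

lemma red_homology_deletion_or_link:
  fixes K :: "'a::linorder set set"
  assumes K: "complex K" and nz: "red_homology_nonzero TYPE('k::field) K m"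
  shows "red_homology_nonzero TYPE('k) (deletion K x) m \<or>
    (\<exists>n. m = Suc n \<and> red_homology_nonzero TYPE('k) (link K x) n)"
proof (rule ccontr)
  let ?D = "deletion K x" and ?L = "link K x"
  assume "\<not> ?thesis"
  then have D: "\<not> red_homology_nonzero TYPE('k) ?D m"
    and L: "\<And>n. m = Suc n \<Longrightarrow> \<not> red_homology_nonzero TYPE('k) ?L n" by auto
  obtain z :: "'a set \<Rightarrow> 'k" where z: "chain K m z" "bd K z = (\<lambda>_. 0)"
    and nb: "\<not> (\<exists>w :: 'a set \<Rightarrow> 'k. chain K (m + 1) w \<and> bd K w = z)"
    using nz unfolding red_homology_nonzero_def by blast
  have "\<exists>w :: 'a set \<Rightarrow> 'k. chain K (Suc m) w \<and> bd K w = z"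
  proof (cases m)
    case 0
    have zD: "chain ?D m z" and zp: "z = chain_pair x z (\<lambda>_. 0)"
      using chain_0_chain_pair K z(1) 0 by blast+
    have "bd ?D z = (\<lambda>_. 0)"
      using bd_subcomplex[OF K complex_deletion[OF K] _ zD] z(2) by (auto simp: deletion_def)
    then obtain s where s: "chain ?D (Suc m) s" "bd ?D s = z"
      using red_homology_zeroD[OF D zD] by blast
    have "bd K (chain_pair x s (\<lambda>_. 0)) = z"
      unfolding bd_chain_pair[OF K chain_zero] using zp by (simp add: s bd_zero)
    then show ?thesis using chain_chain_pair[OF K s(1) chain_zero] by blast
  next
    case (Suc n)
    obtain p q where p: "chain ?D m p" and q: "chain ?L n q" and zp: "z = chain_pair x p q"
      using chain_pair_cases[OF K z(1)[unfolded Suc]] Suc by metis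
    have *: "chain_pair x (\<lambda>\<tau>. bd ?D p \<tau> + q \<tau>) (\<lambda>\<tau>. - bd ?L q \<tau>) = (\<lambda>_. 0)"
      using z(2) unfolding zp bd_chain_pair[OF K q] .
    \<comment> \<open>For \<open>x \<notin> \<tau>\<close>, evaluating at \<open>\<tau>\<close>
      gives the first equation and at \<open>insert x \<tau>\<close> the second. For
      \<open>x \<in> \<tau>\<close>, every term vanishes by its support.\<close>
    have eq: "bd ?D p \<tau> + q \<tau> = 0 \<and> bd ?L q \<tau> = 0" for \<tau>
    proof (cases "x \<in> \<tau>")
      case True
      then have "\<tau> \<notin> ?D" "\<tau> \<notin> ?L" by (auto simp: deletion_def link_def)
      then show ?thesis using q by (auto simp: bd_def chain_def)
    next
      case False
      then show ?thesis
        using fun_cong[OF *, of \<tau>] fun_cong[OF *, of "insert x \<tau>"]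
        by (simp add: chain_pair_def)
    qed
    then have "bd ?L q = (\<lambda>_. 0)" by blast
    then obtain r where r: "chain ?L m r" "bd ?L r = q"
      using red_homology_zeroD[OF L[OF Suc] q] Suc by blast
    have rD: "bd ?D r = q"
      using bd_subcomplex[OF complex_deletion[OF K] complex_link[OF K] link_subset_deletion[OF K] r(1)]
        r(2) by simp
    have "bd ?D (\<lambda>\<sigma>. p \<sigma> + r \<sigma>) = (\<lambda>_. 0)"
      unfolding bd_add rD using eq by auto
    moreover have "chain ?D m (\<lambda>\<sigma>. p \<sigma> + r \<sigma>)"
      using chain_add p chain_mono[OF r(1) link_subset_deletion[OF K]] by blast
    ultimately obtain s where s: "chain ?D (Suc m) s" "bd ?D s = (\<lambda>\<sigma>. p \<sigma> + r \<sigma>)"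
      using red_homology_zeroD[OF D] by blast
    have "bd K (chain_pair x s (\<lambda>\<sigma>. - r \<sigma>)) = z"
      unfolding bd_chain_pair[OF K chain_uminus[OF r(1)]] bd_uminus s r(2) zp by simp
    then show ?thesis using chain_chain_pair[OF K s(1) chain_uminus[OF r(1)]] by blast
  qed
  with nb show False by simp
qed

text \<open>The hypothesis says that \<open>K\<close> is a cone with apex \<open>x\<close>. A cycle
  \<open>(p, q)\<close> satisfies \<open>q = - bd p\<close>, so it is the boundary of
  \<open>(0, p)\<close>, the cone over its part away from \<open>x\<close>.\<close>

lemma red_homology_cone:
  fixes K :: "'a::linorder set set"
  assumes K: "complex K" and cone: "link K x = deletion K x"
  shows "\<not> red_homology_nonzero TYPE('k::field) K m"
proof -
  let ?D = "deletion K x"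
  have "\<exists>w :: 'a set \<Rightarrow> 'k. chain K (m + 1) w \<and> bd K w = z"
    if z: "chain K m z" "bd K z = (\<lambda>_. 0)" for z :: "'a set \<Rightarrow> 'k"
  proof -
    obtain p q where p: "chain ?D m p" and zp: "z = chain_pair x p q"
      and q: "q = (\<lambda>\<tau>. - bd ?D p \<tau>)"
    proof (cases m)
      case 0
      have zD: "chain ?D m z" and zp: "z = chain_pair x z (\<lambda>_. 0)"
        using chain_0_chain_pair K z(1) 0 by blast+
      have "bd ?D z = (\<lambda>_. 0)"
        using bd_subcomplex[OF K complex_deletion[OF K] _ zD] z(2) by (auto simp: deletion_def)
      then show ?thesis using that[OF zD zp] by simp
    next
      case (Suc n)
      obtain p q where p: "chain ?D m p" and q: "chain (link K x) n q"
        and zp: "z = chain_pair x p q"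
        using chain_pair_cases[OF K z(1)[unfolded Suc]] Suc by metis
      have *: "chain_pair x (\<lambda>\<tau>. bd ?D p \<tau> + q \<tau>) (\<lambda>\<tau>. - bd (link K x) q \<tau>) = (\<lambda>_. 0)"
        using z(2) unfolding zp bd_chain_pair[OF K q] .
      have "q \<tau> = - bd ?D p \<tau>" for \<tau>
      proof (cases "x \<in> \<tau>")
        case True
        then have "\<tau> \<notin> ?D" "\<tau> \<notin> link K x" by (auto simp: deletion_def link_def)
        then show ?thesis using q by (auto simp: bd_def chain_def)
      next
        case False
        then show ?thesis
          using fun_cong[OF *, of \<tau>] by (simp add: chain_pair_def eq_neg_iff_add_eq_0 add.commute)
      qed
      then show ?thesis using that[OF p zp] by blast
    qed
    have "bd K (chain_pair x (\<lambda>_. 0) p) = z"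
      unfolding bd_chain_pair[OF K p[folded cone]] cone bd_zero zp q by simp
    then show ?thesis using chain_chain_pair[OF K chain_zero p[folded cone]] by auto
  qed
  then show ?thesis unfolding red_homology_nonzero_def by blast
qed

text \<open>By \<open>cone\<close>, the deletion of \<open>a\<close> is a cone with apex
  \<open>b\<close> over the link of \<open>a\<close>, so \<open>K\<close> is the suspension of that
  link with poles \<open>a\<close> and \<open>b\<close>. A cycle \<open>z\<close> of the link is
  suspended to the difference of its cones over \<open>a\<close> and over \<open>b\<close>; if this
  bounds \<open>(s, t)\<close>, then \<open>-t\<close> already bounds \<open>z\<close> in the
  link.\<close>

lemma red_homology_suspension:
  fixes K :: "'a::linorder set set"
  assumes K: "complex K"
    and cone: "link (deletion K a) b = link K a" "deletion (deletion K a) b = link K a"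
    and nz: "red_homology_nonzero TYPE('k::field) (link K a) m"
  shows "red_homology_nonzero TYPE('k) K (Suc m)"
proof -
  let ?D = "deletion K a" and ?L = "link K a"
  have D: "complex ?D" by (rule complex_deletion[OF K])
  obtain z :: "'a set \<Rightarrow> 'k" where z: "chain ?L m z" "bd ?L z = (\<lambda>_. 0)"
    and nb: "\<not> (\<exists>w :: 'a set \<Rightarrow> 'k. chain ?L (m + 1) w \<and> bd ?L w = z)"
    using nz unfolding red_homology_nonzero_def by blast
  define r where "r = chain_pair b (\<lambda>_. 0) z"
  have zb: "chain (link ?D b) m z" using z(1) cone by simp
  have r: "chain ?D (Suc m) r"
    unfolding r_def using chain_chain_pair[OF D chain_zero zb] .
  \<comment> \<open>\<open>chain_pair\<close> drops the values of its first part at sets containing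
    \<open>b\<close>, so \<open>z\<close> must vanish there for \<open>bd ?D r\<close> to be all of
    \<open>z\<close>.\<close>
  have "z \<tau> = 0" if "b \<in> \<tau>" for \<tau>
    using zb that unfolding chain_def link_def by blast
  then have rz: "bd ?D r = z"
    unfolding r_def bd_chain_pair[OF D zb] cone bd_zero z(2) by (auto simp: chain_pair_def)
  let ?Z = "chain_pair a (\<lambda>\<sigma>. - r \<sigma>) z"
  have "chain K (Suc m) ?Z"
    using chain_chain_pair[OF K chain_uminus[OF r] z(1)] .
  moreover have "bd K ?Z = (\<lambda>_. 0)"
    unfolding bd_chain_pair[OF K z(1)] bd_uminus rz z(2) by (auto simp: chain_pair_def)
  moreover have False if w: "chain K (Suc (Suc m)) w" "bd K w = ?Z" for w
  proof -
    obtain s t where s: "chain ?D (Suc (Suc m)) s" and t: "chain ?L (Suc m) t"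
      and wp: "w = chain_pair a s t"
      using chain_pair_cases[OF K w(1)] by metis
    have *: "chain_pair a (\<lambda>\<tau>. bd ?D s \<tau> + t \<tau>) (\<lambda>\<tau>. - bd ?L t \<tau>) = ?Z"
      using w(2) unfolding wp bd_chain_pair[OF K t] .
    have "- bd ?L t \<tau> = z \<tau>" for \<tau>
    proof (cases "a \<in> \<tau>")
      case True
      then have "\<tau> \<notin> ?L" by (auto simp: link_def)
      then show ?thesis using z(1) by (auto simp: bd_def chain_def)
    next
      case False
      then show ?thesis using fun_cong[OF *, of "insert a \<tau>"]
        by (simp add: chain_pair_def del: mult_minus_right)
    qed
    then have "bd ?L (\<lambda>\<sigma>. - t \<sigma>) = z" unfolding bd_uminus by blast
    with nb chain_uminus[OF t] show False by auto
  qed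
  ultimately show ?thesis unfolding red_homology_nonzero_def by auto
qed

section \<open>Independence complexes\<close>

lemma complex_Ind: "finite S \<Longrightarrow> complex (Ind E S)"
  unfolding complex_def Ind_def by (auto intro: finite_subset[of _ "Pow S"] finite_subset)

lemma deletion_Ind: "deletion (Ind E S) x = Ind E (S - {x})"
  unfolding deletion_def Ind_def by auto

lemma link_Ind:
  assumes "x \<in> S" "{x} \<notin> E"
  shows "link (Ind E S) x = Ind E (S - insert x {y. {x, y} \<in> E})"
  using assms unfolding link_def Ind_def by (auto simp: insert_commute)

text \<open>An isolated vertex can be added to every independent set, so the complex is a cone with
  that vertex as apex.\<close>

lemma red_homology_Ind_isolated:
  fixes S :: "'a::linorder set"
  assumes "finite S" "x \<in> S" "{x} \<notin> E" "\<And>y. y \<in> S \<Longrightarrow> {x, y} \<notin> E"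
  shows "\<not> red_homology_nonzero TYPE('k::field) (Ind E S) m"
proof (rule red_homology_cone[OF complex_Ind])
  have "S - insert x {y. {x, y} \<in> E} = S - {x}" using assms by auto
  then show "link (Ind E S) x = deletion (Ind E S) x"
    using assms by (simp add: link_Ind deletion_Ind)
qed (rule assms)

text \<open>If the neighbourhood of \<open>x\<close> is contained in that of \<open>a\<close>, then \<open>x\<close> is isolated outside the
  closed neighbourhood of \<open>a\<close>, so the link of \<open>a\<close> is a cone.\<close>
lemma red_homology_Ind_fold:
  fixes S :: "'a::linorder set"
  assumes "finite S" "x \<in> S" "a \<in> S" "a \<noteq> x" "\<And>v. {v} \<notin> E"
    and sub: "\<And>y. y \<in> S \<Longrightarrow> {x, y} \<in> E \<Longrightarrow> {a, y} \<in> E"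
    and nz: "red_homology_nonzero TYPE('k::field) (Ind E S) m"
  shows "red_homology_nonzero TYPE('k) (Ind E (S - {a})) m"
proof -
  \<comment> \<open>If \<open>ax\<close> were an edge, \<open>sub\<close> with \<open>y = a\<close>
    would make \<open>a\<close> a loop. Hence \<open>x\<close> survives the removal of the closed
    neighbourhood of \<open>a\<close>.\<close>
  have "{a, x} \<notin> E" using sub[of a] assms by (auto simp: insert_commute)
  then have "\<not> red_homology_nonzero TYPE('k) (Ind E (S - insert a {y. {a, y} \<in> E})) n" for n
    using assms by (intro red_homology_Ind_isolated[of _ x]) auto
  then show ?thesis
    using red_homology_deletion_or_link[OF complex_Ind nz, of a] assms
    by (auto simp: link_Ind deletion_Ind)
qed

section \<open>Homology from an induced matching\<close>

lemma induced_matching_subset: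
  "induced_matching E M \<Longrightarrow> F \<subseteq> M \<Longrightarrow> induced_matching E F"
  unfolding induced_matching_def by (meson order_trans subsetD)

lemma red_homology_induced_matching:
  fixes E :: "'a::linorder set set"
  assumes "finite M" "induced_matching E M" and E: "\<And>e. e \<in> E \<Longrightarrow> card e = 2"
  shows "red_homology_nonzero TYPE('k::field) (Ind E (\<Union>M)) (card M)"
  using assms(1,2)
proof (induction M rule: finite_induct)
  case empty
  \<comment> \<open>The indicator of the empty face is a nonzero cycle, and every boundary in the
    complex \<open>{{}}\<close> is zero.\<close>
  let ?z = "\<lambda>\<sigma> :: 'a set. if \<sigma> = {} then 1 else 0 :: 'k"
  have Ind: "Ind E (\<Union>{}) = {{}}" unfolding Ind_def by auto
  have "chain (Ind E (\<Union>{})) 0 ?z" unfolding Ind chain_def by auto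
  moreover have "bd (Ind E (\<Union>{})) w = (\<lambda>_. 0)" for w :: "'a set \<Rightarrow> 'k"
    unfolding Ind bd_def by auto
  moreover have "?z \<noteq> (\<lambda>_. 0)" by (metis zero_neq_one)
  ultimately show ?case unfolding red_homology_nonzero_def by auto
next
  case (insert e F)
  have loop: "{v} \<notin> E" for v using E[of "{v}"] by auto
  have eE: "e \<in> E" using insert.prems unfolding induced_matching_def by blast
  then obtain a b where e: "e = {a, b}" "a \<noteq> b"
    using E[OF eE] unfolding card_2_iff by blast
  have F: "e \<inter> f = {} \<and> (\<forall>u\<in>e. \<forall>v\<in>f. {u, v} \<notin> E)" if "f \<in> F" for f
  proof -
    have "e \<noteq> f" using that insert.hyps by blast
    with that insert.prems show ?thesis unfolding induced_matching_def by simp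
  qed
  have fin: "finite (\<Union>(insert e F))"
  proof (rule finite_Union)
    show "finite (insert e F)" using insert by simp
    show "finite f" if "f \<in> insert e F" for f
      using insert.prems that E unfolding induced_matching_def
      by (metis card.infinite subsetD zero_neq_numeral)
  qed
  let ?U = "\<Union>(insert e F)"
  have ab: "a \<notin> \<Union>F" "b \<notin> \<Union>F" "\<And>u. u \<in> \<Union>F \<Longrightarrow> {a, u} \<notin> E \<and> {b, u} \<notin> E"
    using F e by auto
  have U: "?U = insert a (insert b (\<Union>F))" "{a, b} \<in> E" "{b, a} \<in> E"
    using e eE by (auto simp: insert_commute)
  \<comment> \<open>Within \<open>?U\<close> the ends \<open>a\<close> and \<open>b\<close> have
    only each other as neighbours, so they serve as the poles of a suspension over
    \<open>\<Union>F\<close>.\<close>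
  have *: "?U - insert a {y. {a, y} \<in> E} = \<Union>F" "?U - {a} - {b} = \<Union>F"
    "?U - {a} - insert b {y. {b, y} \<in> E} = \<Union>F"
    unfolding U(1) using ab U(2,3) by auto
  have "link (Ind E ?U) a = Ind E (\<Union>F)"
    using * e loop by (subst link_Ind) auto
  moreover have "link (deletion (Ind E ?U) a) b = Ind E (\<Union>F)"
    unfolding deletion_Ind using * e loop by (subst link_Ind) auto
  moreover have "deletion (deletion (Ind E ?U) a) b = Ind E (\<Union>F)"
    unfolding deletion_Ind * ..
  moreover have "red_homology_nonzero TYPE('k) (Ind E (\<Union>F)) (card F)"
    using insert.IH induced_matching_subset[OF insert.prems] by blast
  ultimately have "red_homology_nonzero TYPE('k) (Ind E ?U) (Suc (card F))"
    by (intro red_homology_suspension[of _ a b] complex_Ind fin) auto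
  then show ?case using insert by simp
qed

section \<open>An induced matching from homology\<close>

lemma induced_matching_insert:
  assumes "induced_matching E M" "{x, y} \<in> E" "x \<notin> \<Union>M" "y \<notin> \<Union>M"
    and "\<And>u. u \<in> \<Union>M \<Longrightarrow> {x, u} \<notin> E \<and> {y, u} \<notin> E"
  shows "induced_matching E (insert {x, y} M)"
  using assms unfolding induced_matching_def by (auto simp: insert_commute)

text \<open>Only pairs in path order are asked for; symmetry of \<open>{u, v}\<close> supplies the
  reversed ones and the absence of loops the diagonal.\<close>

lemma has_induced_path_6I:
  assumes "distinct [a, b, c, d, e, f]" "{a, b, c, d, e, f} \<subseteq> V" "\<And>v. {v} \<notin> E"
    and "{a, b} \<in> E" "{b, c} \<in> E" "{c, d} \<in> E" "{d, e} \<in> E" "{e, f} \<in> E"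
    and "{a, c} \<notin> E" "{a, d} \<notin> E" "{a, e} \<notin> E" "{a, f} \<notin> E"
    and "{b, d} \<notin> E" "{b, e} \<notin> E" "{b, f} \<notin> E"
    and "{c, e} \<notin> E" "{c, f} \<notin> E" "{d, f} \<notin> E"
  shows "has_induced_path 6 V E"
  unfolding has_induced_path_def
proof (intro exI[of _ "nth [a, b, c, d, e, f]"] conjI)
  let ?p = "nth [a, b, c, d, e, f]"
  have sym: "{u, v} \<in> E \<Longrightarrow> {v, u} \<in> E" "{u, v} \<notin> E \<Longrightarrow> {v, u} \<notin> E" for u v
    by (simp_all add: insert_commute)
  show "inj_on ?p {0..<6}" using inj_on_nth[OF assms(1)] by simp
  have "?p ` {0..<6} \<subseteq> set [a, b, c, d, e, f]"
    by (auto intro: nth_mem simp del: set_simps)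
  then show "?p ` {0..<6} \<subseteq> V" using assms(2) by auto
  show "\<forall>i<6. \<forall>j<6. {?p i, ?p j} \<in> E \<longleftrightarrow> (i = j + 1 \<or> j = i + 1)"
    by (simp add: numeral_eq_Suc All_less_Suc assms(3-18) assms(4-8)[THEN sym(1)]
        assms(9-18)[THEN sym(2)])
qed

text \<open>Let \<open>T y\<close> be the set of matched vertices adjacent to a neighbour \<open>y\<close> of \<open>x\<close>. If some
  \<open>T y\<close> is empty, then \<open>xy\<close> extends the matching. Otherwise \<open>P\<^sub>6\<close>-freeness makes the \<open>T y\<close> a
  chain, and any member of the smallest one is adjacent to all neighbours of \<open>x\<close>.\<close>
lemma induced_matching_extend:
  assumes graph: "simple_graph V E" and bip: "\<And>u v. {u, v} \<in> E \<Longrightarrow> u \<in> A \<longleftrightarrow> v \<notin> A"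
    and path: "\<not> has_induced_path 6 V E" and S: "S \<subseteq> V" "x \<in> S"
    and M: "induced_matching E M" "\<Union>M \<subseteq> S - insert x {y. {x, y} \<in> E}"
    and nonisolated: "\<exists>y\<in>S. {x, y} \<in> E"
    and no_fold: "\<And>a. a \<in> S \<Longrightarrow> a \<noteq> x \<Longrightarrow> \<exists>y\<in>S. {x, y} \<in> E \<and> {a, y} \<notin> E"
  shows "\<exists>M'. induced_matching E M' \<and> \<Union>M' \<subseteq> S \<and> card M' = Suc (card M)"
proof (rule ccontr)
  assume none: "\<not> ?thesis"
  have loop: "{v} \<notin> E" for v using graph unfolding simple_graph_def by force
  have finS: "finite S" using graph S finite_subset unfolding simple_graph_def by blast
  have finM: "finite M" using finite_UnionD[OF finite_subset[OF M(2)]] finS by blast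
  define N where "N = {y\<in>S. {x, y} \<in> E}"
  define T where "T y = {a\<in>\<Union>M. {a, y} \<in> E}" for y
  have finT: "finite (T y)" for y
    using finite_subset[OF _ finS, of "T y"] M(2) by (auto simp: T_def)
  have T_nonempty: "T y \<noteq> {}" if y: "y \<in> N" for y
  proof
    assume "T y = {}"
    then have "{y, u} \<notin> E" if "u \<in> \<Union>M" for u
      using that unfolding T_def by (auto simp: insert_commute)
    moreover have "{x, u} \<notin> E" "x \<notin> \<Union>M" "y \<notin> \<Union>M" if "u \<in> \<Union>M" for u
      using that M(2) y by (auto simp: N_def)
    ultimately have "induced_matching E (insert {x, y} M)"
      using M y by (intro induced_matching_insert) (auto simp: N_def)
    moreover have "{x, y} \<notin> M" using M(2) by blast
    moreover have "\<Union>(insert {x, y} M) \<subseteq> S" using M(2) S y by (auto simp: N_def)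
    ultimately show False using none finM by (metis card_insert_disjoint)
  qed
  have T_chain: "T y \<subseteq> T y' \<or> T y' \<subseteq> T y" if y: "y \<in> N" "y' \<in> N" for y y'
  proof (rule ccontr)
    assume "\<not> ?thesis"
    \<comment> \<open>With \<open>b\<close> the partner of \<open>a\<close> in the matching, the
      induced path will be \<open>b, a, y, x, y', a'\<close>. Pairs on the same side are nonadjacent
      by bipartiteness; the others are excluded by the choice of \<open>a\<close> and
      \<open>a'\<close>, by the matching avoiding neighbours of \<open>x\<close>, and by its being
      induced.\<close>
    then obtain a a' where a: "a \<in> T y" "a \<notin> T y'" "a' \<in> T y'" "a' \<notin> T y" by blast
    then obtain e e' where e: "e \<in> M" "a \<in> e" "e' \<in> M" "a' \<in> e'"
      by (auto simp: T_def)
    then have "e \<in> E" "e' \<in> E" using M(1) unfolding induced_matching_def by auto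
    then have "card e = 2" using graph unfolding simple_graph_def by blast
    then obtain b where b: "e = {b, a}" "b \<noteq> a"
      using e(2) by (metis card_2_iff insert_commute insertE singletonD)
    have bM: "a \<in> \<Union>M" "a' \<in> \<Union>M" "b \<in> \<Union>M" using e b by auto
    have E: "{b, a} \<in> E" "{a, y} \<in> E" "{x, y} \<in> E" "{x, y'} \<in> E" "{a', y'} \<in> E"
      "{a, y'} \<notin> E" "{a', y} \<notin> E" "{x, b} \<notin> E"
      using \<open>e \<in> E\<close> a y bM M(2) b by (auto simp: T_def N_def)
    have side: "a \<in> A \<longleftrightarrow> x \<in> A" "a' \<in> A \<longleftrightarrow> x \<in> A" "b \<in> A \<longleftrightarrow> x \<notin> A"
      "y \<in> A \<longleftrightarrow> x \<notin> A" "y' \<in> A \<longleftrightarrow> x \<notin> A"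
      using E bip by blast+
    \<comment> \<open>\<open>y'\<close> separates \<open>a'\<close> from \<open>a\<close>, and the
      bipartition separates \<open>a'\<close> from \<open>b\<close>. So \<open>a'\<close> lies on
      another matching edge and cannot be adjacent to \<open>b\<close>.\<close>
    have "a' \<noteq> a" "a' \<noteq> b" using E(5,6) side by blast+
    then have "e \<noteq> e'" using e(4) b by blast
    then have "\<forall>u\<in>e. \<forall>v\<in>e'. {u, v} \<notin> E"
      using M(1) e(1,3) unfolding induced_matching_def by metis
    then have "{b, a'} \<notin> E" using e(4) b(1) by simp
    have "has_induced_path 6 V E"
    proof (rule has_induced_path_6I[of b a y x y' a'])
      show "distinct [b, a, y, x, y', a']"
        using E side \<open>a' \<noteq> b\<close> \<open>a' \<noteq> a\<close> b(2) by (auto simp: insert_commute)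
      show "{b, a, y, x, y', a'} \<subseteq> V"
        using bM M(2) S y by (auto simp: N_def)
      have same: "{u, v} \<notin> E" if "u \<in> A \<longleftrightarrow> v \<in> A" for u v
        using bip that by blast
      show "{b, y} \<notin> E" "{b, y'} \<notin> E" "{a, x} \<notin> E" "{a, a'} \<notin> E" "{y, y'} \<notin> E" "{x, a'} \<notin> E"
        by (simp_all add: same side)
    qed (use E loop \<open>{b, a'} \<notin> E\<close> in \<open>simp_all add: insert_commute\<close>)
    with path show False by blast
  qed
  obtain y0 where y0: "y0 \<in> N" "\<And>y. y \<in> N \<Longrightarrow> card (T y0) \<le> card (T y)"
    using nonisolated ex_has_least_nat[of "\<lambda>y. y \<in> N" _ "\<lambda>y. card (T y)"]
    unfolding N_def by blast
  \<comment> \<open>By comparability the only other case is \<open>T y \<subseteq> T y0\<close>,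
    where minimal cardinality forces equality.\<close>
  have least: "T y0 \<subseteq> T y" if "y \<in> N" for y
    using T_chain[OF that y0(1)] y0(2)[OF that] card_seteq[OF finT] by blast
  obtain a where a: "a \<in> T y0" using T_nonempty[OF y0(1)] by blast
  then have "a \<in> S" "a \<noteq> x" using M(2) by (auto simp: T_def)
  then obtain y where "y \<in> N" "{a, y} \<notin> E" using no_fold unfolding N_def by blast
  then show False using least a unfolding T_def by blast
qed

text \<open>Induction over proper subsets of \<open>S\<close>. The bound
  \<open>\<Union>M \<subseteq> S\<close> is carried along so that, in the link case, the smaller
  matching avoids the closed neighbourhood of \<open>x\<close>.\<close>

lemma red_homology_Ind_imp_induced_matching:
  fixes V :: "'a::linorder set"
  assumes graph: "simple_graph V E" and bip: "bipartite V E"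
    and path: "\<not> has_induced_path 6 V E" and "S \<subseteq> V"
    and "red_homology_nonzero TYPE('k::field) (Ind E S) j"
  shows "\<exists>M. induced_matching E M \<and> \<Union>M \<subseteq> S \<and> card M = j"
proof -
  have loop: "{v} \<notin> E" for v using graph unfolding simple_graph_def by force
  obtain A where A: "{u, v} \<in> E \<Longrightarrow> u \<in> A \<longleftrightarrow> v \<notin> A" for u v
  proof -
    from bip obtain A B where AB: "A \<inter> B = {}" "\<And>e. e \<in> E \<Longrightarrow> e \<inter> A \<noteq> {} \<and> e \<inter> B \<noteq> {}"
      unfolding bipartite_def by metis
    show ?thesis
    proof (rule that[of A])
      fix u v assume "{u, v} \<in> E"
      from AB(2)[OF this] AB(1) show "u \<in> A \<longleftrightarrow> v \<notin> A" by auto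
    qed
  qed
  have "finite S" using assms(4) graph finite_subset unfolding simple_graph_def by blast
  then show ?thesis
    using assms(4,5)
  proof (induction S arbitrary: j rule: finite_psubset_induct)
    case (psubset S)
    note nz = psubset.prems(2)
    show ?case
    proof (cases "S = {}")
      case True
      have "j = 0"
      proof (rule ccontr)
        assume "j \<noteq> 0"
        \<comment> \<open>The only possible face is the empty one, so there are no nonzero chains in
          positive degree.\<close>
        then have "z = (\<lambda>_. 0)" if "chain (Ind E S) j z" for z :: "'a set \<Rightarrow> 'k"
          using that True unfolding chain_def Ind_def by fastforce
        then show False
          using nz chain_zero bd_zero unfolding red_homology_nonzero_def by blast
      qed
      then show ?thesis by (intro exI[of _ "{}"]) (simp add: induced_matching_def)
    next
      case False
      then obtain x where x: "x \<in> S" by blast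
      have smaller: "\<exists>M. induced_matching E M \<and> \<Union>M \<subseteq> S' \<and> card M = i"
        if "red_homology_nonzero TYPE('k) (Ind E S') i" "S' \<subset> S" for S' i
        using psubset.IH[OF that(2) _ that(1)] that(2) psubset.prems(1) by blast
      have nonisolated: "\<exists>y\<in>S. {x, y} \<in> E"
        using red_homology_Ind_isolated[OF psubset.hyps x loop] nz by blast
      show ?thesis
      \<comment> \<open>Dominating vertices are removed first; their absence is what
        \<open>induced_matching_extend\<close> requires below. There the added edge makes up for the
        degree lost in passing to the link.\<close>
      proof (cases "\<exists>a\<in>S. a \<noteq> x \<and> (\<forall>y\<in>S. {x, y} \<in> E \<longrightarrow> {a, y} \<in> E)")
        case True
        then obtain a where a: "a \<in> S" "a \<noteq> x" "\<And>y. y \<in> S \<Longrightarrow> {x, y} \<in> E \<Longrightarrow> {a, y} \<in> E"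
          by blast
        have "red_homology_nonzero TYPE('k) (Ind E (S - {a})) j"
          using red_homology_Ind_fold[OF psubset.hyps x a(1,2) loop a(3) nz] .
        then show ?thesis using smaller[of "S - {a}"] a(1) by blast
      next
        case no_fold: False
        let ?R = "S - insert x {y. {x, y} \<in> E}"
        consider "red_homology_nonzero TYPE('k) (Ind E (S - {x})) j"
          | i where "j = Suc i" "red_homology_nonzero TYPE('k) (Ind E ?R) i"
          using red_homology_deletion_or_link[OF complex_Ind[OF psubset.hyps] nz, of x]
          by (auto simp: deletion_Ind link_Ind[of x S E, OF x loop])
        then show ?thesis
        proof cases
          case 1
          then show ?thesis using smaller[of "S - {x}"] x by blast
        next
          case 2
          obtain M where M: "induced_matching E M" "\<Union>M \<subseteq> ?R" "card M = i"
            using smaller[OF 2(2)] x by blast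
          have "\<exists>M'. induced_matching E M' \<and> \<Union>M' \<subseteq> S \<and> card M' = Suc (card M)"
          proof (rule induced_matching_extend[OF graph A path psubset.prems(1) x M(1,2) nonisolated])
            show "\<exists>y\<in>S. {x, y} \<in> E \<and> {a, y} \<notin> E" if "a \<in> S" "a \<noteq> x" for a
              using no_fold that by blast
          qed
          then show ?thesis unfolding M(3) 2(1) .
        qed
      qed
    qed
  qed
qed

theorem mainTheorem6:
  fixes V :: "'a::linorder set" and E :: "'a set set"
  assumes "simple_graph V E"
    and "bipartite V E"
    and "\<not> has_induced_path 6 V E"
  shows "reg TYPE('k::field) V E = im E"
proof -
  have "E \<subseteq> Pow V" "finite V" and E: "\<And>e. e \<in> E \<Longrightarrow> card e = 2"
    using assms(1) unfolding simple_graph_def by auto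
  then have "finite E" using finite_subset by blast
  have sub: "\<Union>M \<subseteq> V" "finite M" if "induced_matching E M" for M
  proof -
    have "M \<subseteq> E" using that unfolding induced_matching_def by blast
    then show "\<Union>M \<subseteq> V" "finite M"
      using \<open>E \<subseteq> Pow V\<close> \<open>finite E\<close> finite_subset by blast+
  qed
  \<comment> \<open>Both maxima are taken over the same set of numbers, not merely over sets with
    the same upper bound.\<close>
  have "(\<exists>S\<subseteq>V. red_homology_nonzero TYPE('k) (Ind E S) j) \<longleftrightarrow>
      (\<exists>M. j = card M \<and> induced_matching E M)" for j
  proof
    assume "\<exists>S\<subseteq>V. red_homology_nonzero TYPE('k) (Ind E S) j"
    then obtain S where "S \<subseteq> V" "red_homology_nonzero TYPE('k) (Ind E S) j" by blast
    from red_homology_Ind_imp_induced_matching[OF assms this]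
    show "\<exists>M. j = card M \<and> induced_matching E M" by metis
  next
    assume "\<exists>M. j = card M \<and> induced_matching E M"
    then obtain M where "j = card M" "induced_matching E M" by blast
    then show "\<exists>S\<subseteq>V. red_homology_nonzero TYPE('k) (Ind E S) j"
      using red_homology_induced_matching[OF sub(2) _ E] sub(1) by metis
  qed
  then show ?thesis unfolding reg_def im_def by simp
qed

end
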